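(* Let $\mathbb{K}\in\{\mathbb{R},\mathbb{C}\}$, let $\mathcal{A}$ be a unitary Banach algebra over $\mathbb{K}$, let $\{\alpha_n\}_{n\in\mathbb{N}}\subset\mathbb{K}$ be such that the radius of convergence of $g(\lambda)=\sum_{n=0}^\infty\alpha_n\lambda^n$ is $R>0$, and let $0<r<R$. Let $X$ be a Banach space over $\mathbb{K}$, $D\subseteq X$ an open set, and $\mathcal{T}:D\to\mathcal{A}$ a Fréchet differentiable mapping such that either $\mathcal{T}(D)\subseteq B_r(\mathbf{0})$, or alternatively $D$ is convex and bounded and $\sup_{x\in D}\|\mathcal{T}^{[1]}(x)\|_{B(X,\mathcal{A})}<\infty$. Set $\widetilde{r}=\sup_{x\in D}\|\mathcal{T}(x)\|_{\mathcal{A}}$ and assume $0<\widetilde{r}<R$. Then: (1) For all $x\in D$, $h\in X$ $$\begin{aligned}[g\circ\mathcal{T}]^{[1]}(x)(h)&=\sum_{n=1}^{\infty}n\alpha_n\mathcal{T}^{[1]}(x)(h)\mathcal{T}(x)^{n-1}+\sum_{n=2}^{\infty}\sum_{p=0}^{n-2}(n-p-1)\alpha_n\mathcal{T}(x)^p[\mathcal{T}(x),\mathcal{T}^{[1]}(x)(h)]\mathcal{T}(x)^{n-(2+p)}\\&=\sum_{n=1}^{\infty}n\alpha_n\mathcal{T}^{[1]}(x)(h)\mathcal{T}(x)^{n-1}+\sum_{p=0}^{\infty}\sum_{n=p+2}^{\infty}(n-p-1)\alpha_n\mathcal{T}(x)^p[\mathcal{T}(x),\mathcal{T}^{[1]}(x)(h)]\mathcal{T}(x)^{n-(2+p)}.\end{aligned}$$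 If in addition $\sup_{x\in D}\|\mathcal{T}^{[1]}(x)\|_{B(X,\mathcal{A})}<\infty$, then all these series are absolutely uniformly convergent for $(x,h)\in D\times B_L(\mathbf{0})$, for all $L>0$. (2) For all $x\in D$ $$[g\circ\mathcal{T}]^{[1]}(x)=\sum_{n=1}^{\infty}n\alpha_n\mathcal{L}(\mathcal{T}(x))^{n-1}\mathcal{T}^{[1]}(x)-\sum_{k=2}^{\infty}\left\{\sum_{n=k}^{\infty}\alpha_n\mathcal{L}(\mathcal{T}(x))^{n-k}\right\}C(\mathcal{T}(x)^{k-1})\,\mathcal{T}^{[1]}(x).$$ If in addition $\sup_{x\in D}\|\mathcal{T}^{[1]}(x)\|_{B(X,\mathcal{A})}<\infty$, then all these series are absolutely uniformly convergent on $D$.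
   Context: A Banach algebra is an associative algebra over $\mathbb{K}$ with a complete norm satisfying $\|AB\|\le\|A\|\|B\|$; it is unitary if it has a unit $\mathbf{1}$, and then $\|\mathbf{1}\|=1$ is assumed. $\mathbb{N}=\{0,1,2,\dots\}$. $[A,B]=AB-BA$. $B_r(\mathbf{0})$ is the open ball of radius $r$ about $0$ in the relevant Banach space ($\mathcal{A}$ or $X$). $B(X,\mathcal{A})$ is the Banach space of bounded $\mathbb{K}$-linear maps $X\to\mathcal{A}$ with operator norm and $B(\mathcal{A})=B(\mathcal{A},\mathcal{A})$. For $T\in\mathcal{A}$ define $\mathcal{L}(T),C(T)\in B(\mathcal{A})$ by $\mathcal{L}(T)(h)=hT$ and $C(T)(h)=hT-Th$; products and powers of operators are compositions, with zeroth power the identity. The function $g$ is also regarded as the map $g:B_R(\mathbf{0})\subset\mathcal{A}\to\mathcal{A}$, $g(T)=\sum_n\alpha_nT^n$. For a map $f:U\subseteq F\to G$ between Banach spaces ($U$ open), $f^{[1]}:U\to B(F,G)$ is its Fréchet differential function. A series $\sum_nf_n$ of maps from a set $S$ to a Banach space $Y$ converges absolutely uniformly on $S$ if $\sum_n\sup_{u\in S}\|f_n(u)\|_Y<\infty$. *)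

theory Defs
  imports "HOL-Analysis.Analysis"
begin

(* The scalar field is a type 'k of sort {real_normed_field, banach}.  Both real and complex are
   instances and, by the Gelfand-Mazur theorem, they are the only ones up to isometric isomorphism,
   so a theorem that is polymorphic in 'k is a theorem for the real and for the complex field.

   The type classes fix only the real structure of a Banach space, so the scalar multiplication by
   'k is an explicit parameter.  Completeness is the class banach.
   The assumption scaleR_eq excludes nothing: it says that the real structure is the one obtained
   from 'k by restriction of scalars. *)

locale normed_space_over = vector_space scale
  for scale :: "'k::{real_normed_field,banach} \<Rightarrow> 'v::real_normed_vector \<Rightarrow> 'v" +
  assumes norm_scale: "norm (scale c v) = norm c * norm v"
    and scaleR_eq: "t *\<^sub>R v = scale (of_real t) v"

locale banach_space_over = normed_space_over scale
  for scale :: "'k::{real_normed_field,banach} \<Rightarrow> 'v::banach \<Rightarrow> 'v"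

(* Associativity, the unit, norm 1 = 1 and norm (a * b) \<le> norm a * norm b come from the class
   real_normed_algebra_1. *)
locale unital_banach_algebra_over = banach_space_over scale
  for scale :: "'k::{real_normed_field,banach} \<Rightarrow> 'a::{real_normed_algebra_1,banach} \<Rightarrow> 'a" +
  assumes scale_mult_left: "scale c a * b = scale c (a * b)"
    and scale_mult_right: "a * scale c b = scale c (a * b)"

(* Bounded 'k-linear maps are the elements of the type of bounded real-linear maps that are
   'k-linear.  They form a closed subspace, with the same operator norm, so that limits and series
   of such operators can be formed in the latter type.

   A bounded 'k-linear Frechet differential is in particular the (unique) real one, whence
   fdifferential needs no reference to 'k. *)

definition frechet_differentiable_over ::
  "('k::{real_normed_field,banach} \<Rightarrow> 'x::real_normed_vector \<Rightarrow> 'x) \<Rightarrow>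
   ('k \<Rightarrow> 'y::real_normed_vector \<Rightarrow> 'y) \<Rightarrow> ('x \<Rightarrow> 'y) \<Rightarrow> 'x set \<Rightarrow> bool" where
  "frechet_differentiable_over sX sY f U \<longleftrightarrow>
     (\<forall>x\<in>U. \<exists>S :: 'x \<Rightarrow>\<^sub>L 'y. Vector_Spaces.linear sX sY (blinfun_apply S) \<and>
        (f has_derivative blinfun_apply S) (at x))"

definition fdifferential :: "('x::real_normed_vector \<Rightarrow> 'y::real_normed_vector) \<Rightarrow> 'x \<Rightarrow> 'x \<Rightarrow>\<^sub>L 'y" where
  "fdifferential f x = Blinfun (frechet_derivative f (at x))"

lemma fdifferential_eq:
  assumes "(f has_derivative blinfun_apply S) (at x)"
  shows "fdifferential f x = S"
  unfolding fdifferential_def frechet_derivative_at[OF assms, symmetric] by (rule blinfun_apply_inverse)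

definition power_series_map ::
  "('k \<Rightarrow> 'a::{real_normed_algebra_1,banach} \<Rightarrow> 'a) \<Rightarrow> (nat \<Rightarrow> 'k) \<Rightarrow> 'a \<Rightarrow> 'a" where
  "power_series_map s \<alpha> a = (\<Sum>n. s (\<alpha> n) (a ^ n))"

definition commutator :: "'a::ring \<Rightarrow> 'a \<Rightarrow> 'a" where
  "commutator a b = a * b - b * a"

(* The operators h \<mapsto> h * a and h \<mapsto> h * a - a * h. *)

abbreviation L_op :: "'a::real_normed_algebra \<Rightarrow> 'a \<Rightarrow>\<^sub>L 'a" where
  "L_op \<equiv> blinfun_mult_left"

definition C_op :: "'a::real_normed_algebra \<Rightarrow> 'a \<Rightarrow>\<^sub>L 'a" where
  "C_op a = blinfun_mult_left a - blinfun_mult_right a"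

lemma L_op_apply: "blinfun_apply (L_op a) h = h * a"
  by simp

lemma C_op_apply: "blinfun_apply (C_op a) h = h * a - a * h"
  by (simp add: C_op_def blinfun.diff_left)

definition op_power :: "('v::real_normed_vector \<Rightarrow>\<^sub>L 'v) \<Rightarrow> nat \<Rightarrow> 'v \<Rightarrow>\<^sub>L 'v" where
  "op_power S n = ((\<lambda>U. S o\<^sub>L U) ^^ n) id_blinfun"

definition op_scale ::
  "('k \<Rightarrow> 'w \<Rightarrow> 'w) \<Rightarrow> 'k \<Rightarrow> ('v::real_normed_vector \<Rightarrow>\<^sub>L 'w::real_normed_vector) \<Rightarrow> 'v \<Rightarrow>\<^sub>L 'w" where
  "op_scale s c S = Blinfun (\<lambda>v. s c (blinfun_apply S v))"

lemma (in normed_space_over) bounded_linear_scale: "bounded_linear (scale c)"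
  by (rule bounded_linear_intro[where K = "norm c"])
    (simp_all add: scale_right_distrib scaleR_eq norm_scale mult.commute)

lemma (in normed_space_over) op_scale_apply:
  "blinfun_apply (op_scale scale c S) v = scale c (blinfun_apply S v)"
  unfolding op_scale_def
  by (subst bounded_linear_Blinfun_apply)
    (auto intro: bounded_linear_compose[OF bounded_linear_scale] blinfun.bounded_linear_right)

(* Series over the indices n \<ge> k. *)

definition series_converges_from :: "nat \<Rightarrow> (nat \<Rightarrow> 'v::real_normed_vector) \<Rightarrow> bool" where
  "series_converges_from k f \<longleftrightarrow> summable (\<lambda>n. f (n + k))"

definition series_from :: "nat \<Rightarrow> (nat \<Rightarrow> 'v::real_normed_vector) \<Rightarrow> 'v" where
  "series_from k f = (\<Sum>n. f (n + k))"

definition abs_unif_convergent_from ::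
  "nat \<Rightarrow> 's set \<Rightarrow> (nat \<Rightarrow> 's \<Rightarrow> 'v::real_normed_vector) \<Rightarrow> bool" where
  "abs_unif_convergent_from k S f \<longleftrightarrow> (\<Sum>n. SUP u\<in>S. ennreal (norm (f (n + k) u))) < \<infinity>"

end

theory Submission
  imports Defs
begin

text \<open>
  Differentiating \<open>g(a) = \<Sum>n. \<alpha>\<^sub>n a^n\<close> term by term gives
  \<open>g'(a)(h) = \<Sum>n. \<alpha>\<^sub>n (\<Sum>i<n. a^i h a^(n-1-i))\<close>, and the chain rule supplies
  \<open>h = T'(x)(k)\<close> and \<open>a = T x\<close>.  Both formulas of the theorem come from moving \<open>h\<close> to the left of
  every power: \<open>a^i h = h a^i + [a^i, h]\<close>.  The main parts \<open>h a^(n-1)\<close> add up to the first series.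
  Left as they are, the commutators \<open>[a^i, h]\<close> give the operator formula of part (2), since
  \<open>C(a^i)(h) = - [a^i, h]\<close>; expanded by \<open>[a^i, h] = \<Sum>q<i. a^q [a, h] a^(i-1-q)\<close> they give
  part (1), where \<open>a^p [a, h] a^(n-2-p)\<close> occurs once for each \<open>i\<close> with \<open>p < i < n\<close>.
  These finite identities are \<open>power_deriv_eq_commutators\<close> and \<open>sum_commutator_powers\<close>.

  For the convergence, choose \<open>\<rho>\<close> strictly between the supremum of \<open>norm (T x)\<close> and \<open>R\<close>.
  For \<open>norm a \<le> \<rho>\<close> all bounds come, up to constant factors, from the terms of
  \<open>\<Sum>n. norm \<alpha>\<^sub>n * t^n\<close> and of its first two derivatives at \<open>t = \<rho>\<close>, series which converge because
  \<open>\<rho>\<close> is less than the radius of convergence.  The bounds depend on \<open>h\<close> only through an upper bound for its norm, so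
  one estimate serves both pointwise and uniform convergence.  In both parts the commutator terms
  form a triangular array, indexed by \<open>m = n - 2\<close> and \<open>p \<le> m\<close>, and the iterated series are its column
  sums; \<open>triangle_sums\<close> passes between rows and columns for elements of the algebra and for
  operators alike.
\<close>

section \<open>Series with majorants\<close>

text \<open>Extended by zero to the pairs with \<open>p > m\<close>, the array is absolutely summable over all pairs, so it may be
  summed by rows or by columns; column \<open>p\<close> starts on the diagonal, whence the shift \<open>n + p\<close>. The
  column sums of the majorant bound those of \<open>F\<close> uniformly in any parameter of \<open>F\<close>.\<close>

lemma triangle_sums:
  fixes F :: "nat \<Rightarrow> nat \<Rightarrow> 'b::banach" and B :: "nat \<Rightarrow> nat \<Rightarrow> real"
  assumes bound: "\<And>m p. p \<le> m \<Longrightarrow> norm (F m p) \<le> B m p"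
    and summable: "summable (\<lambda>m. \<Sum>p\<le>m. B m p)"
  shows "summable (\<lambda>n. B (n + p) p)"
    and "summable (\<lambda>p. \<Sum>n. B (n + p) p)"
    and "(\<lambda>p. \<Sum>n. F (n + p) p) sums (\<Sum>m. \<Sum>p\<le>m. F m p)"
proof -
  define G where "G = (\<lambda>m p. if p \<le> m then F m p else 0)"
  define H where "H = (\<lambda>m p. if p \<le> m then B m p else 0)"
  have B0: "0 \<le> B m p" if "p \<le> m" for m p
    using bound[OF that] norm_ge_zero order_trans by blast
  have H0: "0 \<le> H m p" and GH: "norm (G m p) \<le> H m p" for m p
    by (auto simp: H_def G_def B0 bound)
  have rowH: "(H m has_sum (\<Sum>p\<le>m. B m p)) UNIV" for m
    by (rule has_sum_finite_neutralI[of "{..m}"]) (auto simp: H_def)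
  have rowG: "(G m has_sum (\<Sum>p\<le>m. F m p)) UNIV" for m
    by (rule has_sum_finite_neutralI[of "{..m}"]) (auto simp: G_def)
  have "(\<lambda>m. \<Sum>p\<le>m. B m p) summable_on UNIV"
    using summable by (subst summable_on_UNIV_nonneg_real_iff) (auto intro!: sum_nonneg B0)
  then have H: "(\<lambda>(m, p). H m p) summable_on UNIV \<times> UNIV"
    using rowH H0 by (intro summable_on_SigmaI[where g = "\<lambda>m. \<Sum>p\<le>m. B m p"]) auto
  then have H': "(\<lambda>(p, m). H m p) summable_on UNIV \<times> UNIV"
    by (subst (asm) summable_on_swap) simp
  have colH: "(\<lambda>m. H m p) summable_on UNIV" for p
    using summable_on_SigmaD1[of "\<lambda>p m. H m p" UNIV "\<lambda>_. UNIV"] H' by simp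
  then have colH_sums: "summable (\<lambda>m. H m p)" for p
    by (rule summable_on_imp_summable)
  have shiftH: "(\<lambda>n. H (n + p) p) = (\<lambda>n. B (n + p) p)" for p
    by (simp add: H_def)
  show sB: "summable (\<lambda>n. B (n + p) p)" for p
    using summable_ignore_initial_segment[OF colH_sums[of p], of p] by (simp add: shiftH)
  have infH: "(\<Sum>\<^sub>\<infinity>m. H m p) = (\<Sum>n. B (n + p) p)" for p
  proof -
    have "(\<Sum>\<^sub>\<infinity>m. H m p) = (\<Sum>m. H m p)"
      by (rule sums_unique[OF has_sum_imp_sums[OF has_sum_infsum[OF colH]]])
    also have "\<dots> = (\<Sum>n. H (n + p) p) + (\<Sum>m<p. H m p)"
      by (rule suminf_split_initial_segment) (rule colH_sums)
    finally show ?thesis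
      unfolding shiftH by (simp add: H_def)
  qed
  have "(\<lambda>p. \<Sum>\<^sub>\<infinity>m. H m p) summable_on UNIV"
    using summable_on_SigmaD[OF H'] colH by simp
  then show "summable (\<lambda>p. \<Sum>n. B (n + p) p)"
    unfolding infH by (rule summable_on_imp_summable)
  have "(\<lambda>x. norm (case x of (m, p) \<Rightarrow> G m p)) summable_on UNIV \<times> UNIV"
    by (rule Infinite_Sum.abs_summable_on_comparison_test'[OF H]) (auto simp: GH)
  then have G: "(\<lambda>(m, p). G m p) summable_on UNIV \<times> UNIV"
    by (rule abs_summable_summable)
  have total: "((\<lambda>m. \<Sum>p\<le>m. F m p) has_sum (\<Sum>m. \<Sum>p\<le>m. F m p)) UNIV"
  proof -
    have total: "((\<lambda>m. \<Sum>p\<le>m. F m p) has_sum infsum (\<lambda>(m, p). G m p) (UNIV \<times> UNIV)) UNIV"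
      by (rule has_sum_SigmaD[OF has_sum_infsum[OF G]]) (simp add: rowG)
    show ?thesis
      using total sums_unique[OF has_sum_imp_sums[OF total]] by simp
  qed
  have "((\<lambda>(m, p). G m p) has_sum (\<Sum>m. \<Sum>p\<le>m. F m p)) (UNIV \<times> UNIV)"
    by (rule has_sum_SigmaI[OF _ total G]) (simp add: rowG)
  then have G': "((\<lambda>(p, m). G m p) has_sum (\<Sum>m. \<Sum>p\<le>m. F m p)) (UNIV \<times> UNIV)"
    by (subst (asm) has_sum_swap) simp
  have colG: "((\<lambda>m. G m p) has_sum (\<Sum>n. F (n + p) p)) UNIV" for p
  proof -
    have s: "summable (\<lambda>m. norm (G m p))"
      by (rule summable_comparison_test'[OF colH_sums[of p], of 0]) (simp add: GH)
    have "(\<Sum>m. G m p) = (\<Sum>n. G (n + p) p) + (\<Sum>m<p. G m p)"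
      by (rule suminf_split_initial_segment) (rule summable_norm_cancel[OF s])
    then have "(\<Sum>m. G m p) = (\<Sum>n. F (n + p) p)"
      by (simp add: G_def)
    then show ?thesis
      using norm_summable_imp_has_sum[OF s summable_sums[OF summable_norm_cancel[OF s]]] by simp
  qed
  have "((\<lambda>p. \<Sum>n. F (n + p) p) has_sum (\<Sum>m. \<Sum>p\<le>m. F m p)) UNIV"
    using has_sum_SigmaD[OF G'] colG by simp
  then show "(\<lambda>p. \<Sum>n. F (n + p) p) sums (\<Sum>m. \<Sum>p\<le>m. F m p)"
    by (rule has_sum_imp_sums)
qed

lemma abs_unif_convergent_fromI:
  assumes bound: "\<And>n u. u \<in> S \<Longrightarrow> norm (f (n + k) u) \<le> B n"
    and "summable B" and nonneg: "\<And>n. 0 \<le> B n"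
  shows "abs_unif_convergent_from k S f"
proof -
  have "(\<Sum>n. SUP u\<in>S. ennreal (norm (f (n + k) u))) \<le> (\<Sum>n. ennreal (B n))"
    by (intro suminf_le SUP_least ennreal_leI bound) auto
  also have "\<dots> = ennreal (\<Sum>n. B n)"
    by (intro suminf_ennreal2 assms)
  finally show ?thesis
    unfolding abs_unif_convergent_from_def by (simp add: order_le_less_trans)
qed

text \<open>The radius of convergence only controls open discs, and the convergence of a
  derived series at a point is drawn from that of the series on a larger disc; hence the number \<open>s\<close>
  between \<open>\<rho>\<close> and the radius.\<close>

lemma summable_diffs_norm:
  fixes \<alpha> :: "nat \<Rightarrow> 'k::{real_normed_field,banach}"
  assumes "0 \<le> \<rho>" "ereal \<rho> < conv_radius \<alpha>"
  shows "summable (\<lambda>n. norm (\<alpha> n) * \<rho> ^ n)"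
    and "summable (\<lambda>n. diffs (\<lambda>n. norm (\<alpha> n)) n * \<rho> ^ n)"
    and "summable (\<lambda>n. diffs (diffs (\<lambda>n. norm (\<alpha> n))) n * \<rho> ^ n)"
proof -
  obtain s where s: "\<rho> < s" "ereal s < conv_radius \<alpha>"
    using ereal_dense2[OF assms(2)] by auto
  have 0: "summable (\<lambda>n. norm (\<alpha> n) * x ^ n)" if "norm x < s" for x
  proof (rule summable_in_conv_radius)
    show "ereal (norm x) < conv_radius (\<lambda>n. norm (\<alpha> n))"
      using that s less_trans[of "ereal (norm x)" "ereal s"] by simp
  qed
  have 1: "summable (\<lambda>n. diffs (\<lambda>n. norm (\<alpha> n)) n * x ^ n)" if "norm x < s" for x
    by (rule termdiff_converges[OF that 0])
  have 2: "summable (\<lambda>n. diffs (diffs (\<lambda>n. norm (\<alpha> n))) n * x ^ n)" if "norm x < s" for x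
    by (rule termdiff_converges[OF that 1])
  have "norm \<rho> < s" using assms s by simp
  then show "summable (\<lambda>n. norm (\<alpha> n) * \<rho> ^ n)"
    "summable (\<lambda>n. diffs (\<lambda>n. norm (\<alpha> n)) n * \<rho> ^ n)"
    "summable (\<lambda>n. diffs (diffs (\<lambda>n. norm (\<alpha> n))) n * \<rho> ^ n)"
    using 0 1 2 by auto
qed

section \<open>The derivative of a power in a noncommutative algebra\<close>

definition power_deriv :: "nat \<Rightarrow> 'a::ring_1 \<Rightarrow> 'a \<Rightarrow> 'a" where
  "power_deriv n a h = (\<Sum>i<n. a ^ i * h * a ^ (n - Suc i))"

lemma power_deriv_0 [simp]: "power_deriv 0 a h = 0"
  by (simp add: power_deriv_def)

lemma power_deriv_Suc: "power_deriv (Suc n) a h = h * a ^ n + a * power_deriv n a h"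
  unfolding power_deriv_def sum.lessThan_Suc_shift
  by (simp add: sum_distrib_left mult.assoc)

lemma has_derivative_power_deriv:
  fixes a :: "'a::real_normed_algebra_1"
  shows "((\<lambda>x. x ^ n) has_derivative power_deriv n a) (at a within S)"
proof (induction n)
  case 0
  then show ?case by (simp add: power_deriv_0[abs_def])
next
  case (Suc n)
  have "((\<lambda>x. x * x ^ n) has_derivative (\<lambda>h. a * power_deriv n a h + h * a ^ n)) (at a within S)"
    by (rule has_derivative_mult[OF has_derivative_ident Suc])
  then show ?case by (simp add: power_deriv_Suc[abs_def] add.commute)
qed

text \<open>The terms of all the series in the algebra are scalar multiples of such products, or finite sums of them.\<close>

lemma norm_sandwich_le:
  fixes a h :: "'a::real_normed_algebra_1"
  assumes "norm a \<le> \<rho>" "norm h \<le> M"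
  shows "norm (a ^ i * h * a ^ j) \<le> \<rho> ^ (i + j) * M"
proof -
  have p: "norm (a ^ k) \<le> \<rho> ^ k" for k
    using norm_power_ineq[of a k] power_mono[OF assms(1) norm_ge_zero, of k] by linarith
  have \<rho>: "0 \<le> \<rho>"
    using norm_ge_zero[of a] assms(1) by linarith
  have "norm (a ^ i * h * a ^ j) \<le> norm (a ^ i) * norm h * norm (a ^ j)"
    by (meson norm_mult_ineq order_trans mult_right_mono norm_ge_zero)
  also have "\<dots> \<le> \<rho> ^ i * M * \<rho> ^ j"
    using \<rho> order_trans[OF norm_ge_zero assms(2)] by (intro mult_mono p assms(2)) auto
  finally show ?thesis by (simp add: power_add mult_ac)
qed

lemma norm_power_deriv_le:
  fixes a h :: "'a::real_normed_algebra_1"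
  assumes "norm a \<le> \<rho>"
  shows "norm (power_deriv n a h) \<le> of_nat n * \<rho> ^ (n - 1) * norm h"
proof -
  have "norm (power_deriv n a h) \<le> (\<Sum>i<n. \<rho> ^ (n - 1) * norm h)"
    unfolding power_deriv_def
  proof (rule sum_norm_le)
    fix i assume "i \<in> {..<n}"
    then have "i + (n - Suc i) = n - 1" by auto
    then show "norm (a ^ i * h * a ^ (n - Suc i)) \<le> \<rho> ^ (n - 1) * norm h"
      using norm_sandwich_le[OF assms order_refl, of i h "n - Suc i"] by simp
  qed
  then show ?thesis by (simp add: mult.assoc)
qed

lemma norm_commutator_le:
  fixes a h :: "'a::real_normed_algebra"
  shows "norm (commutator a h) \<le> 2 * norm a * norm h"
  using norm_triangle_ineq4[of "a * h" "h * a"] norm_mult_ineq[of a h] norm_mult_ineq[of h a]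
  unfolding commutator_def mult.commute[of "norm h"] by linarith

text \<open>The commutator with \<open>h\<close> is a derivation, so this is the product rule for a power.\<close>

lemma commutator_power_Suc:
  fixes a h :: "'a::ring_1"
  shows "commutator (a ^ Suc p) h = (\<Sum>q\<le>p. a ^ q * commutator a h * a ^ (p - q))"
proof (induction p)
  case 0
  then show ?case by simp
next
  case (Suc p)
  have "commutator (a ^ Suc (Suc p)) h = commutator (a ^ Suc p) h * a + a ^ Suc p * commutator a h"
    by (simp only: power_Suc2[of a "Suc p"]) (simp add: commutator_def algebra_simps)
  also have "commutator (a ^ Suc p) h * a = (\<Sum>q\<le>p. a ^ q * commutator a h * a ^ (Suc p - q))"
    unfolding Suc sum_distrib_right
    by (intro sum.cong) (simp_all add: mult.assoc Suc_diff_le power_commutes)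
  finally show ?case by simp
qed

text \<open>Each \<open>a^i h\<close> is replaced by \<open>h a^i + [a^i, h]\<close>. The commutator vanishes for \<open>i = 0\<close>, and the
  index of the remaining sum is \<open>p = i - 1\<close>. Exponents start at 2 because neither \<open>a^0\<close> nor \<open>a^1\<close>
  contributes a commutator.\<close>

lemma power_deriv_eq_commutators:
  fixes a h :: "'a::ring_1"
  shows "power_deriv (m + 2) a h =
    of_nat (m + 2) * (h * a ^ Suc m) + (\<Sum>p\<le>m. commutator (a ^ Suc p) h * a ^ (m - p))"
proof -
  have "power_deriv (m + 2) a h =
      (\<Sum>i<m + 2. h * a ^ Suc m + commutator (a ^ i) h * a ^ (m + 1 - i))"
    unfolding power_deriv_def
  proof (rule sum.cong)
    fix i assume "i \<in> {..<m + 2}"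
    then have "a ^ Suc m = a ^ i * a ^ (m + 1 - i)"
      by (simp flip: power_add)
    then have "h * a ^ Suc m = h * a ^ i * a ^ (m + 1 - i)"
      by (simp only: mult.assoc)
    then show "a ^ i * h * a ^ (m + 2 - Suc i) =
        h * a ^ Suc m + commutator (a ^ i) h * a ^ (m + 1 - i)"
      by (simp add: commutator_def algebra_simps del: power_Suc)
  qed simp
  also have "\<dots> = of_nat (m + 2) * (h * a ^ Suc m) +
      (\<Sum>i<Suc (Suc m). commutator (a ^ i) h * a ^ (m + 1 - i))"
    by (simp add: sum.distrib)
  also have "(\<Sum>i<Suc (Suc m). commutator (a ^ i) h * a ^ (m + 1 - i)) =
      (\<Sum>p\<le>m. commutator (a ^ Suc p) h * a ^ (m - p))"
    by (subst sum.lessThan_Suc_shift) (simp add: commutator_def lessThan_Suc_atMost)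
  finally show ?thesis .
qed

text \<open>Expanding each commutator by the product rule, \<open>a^p [a, h] a^(m-p)\<close> arises from the powers
  \<open>a^(p+1), \<dots>, a^(m+1)\<close>, that is \<open>m + 1 - p\<close> times.\<close>

lemma sum_commutator_powers:
  fixes a h :: "'a::ring_1"
  shows "(\<Sum>p\<le>m. commutator (a ^ Suc p) h * a ^ (m - p)) =
    (\<Sum>p\<le>m. of_nat (Suc m - p) * (a ^ p * commutator a h * a ^ (m - p)))"
proof (induction m)
  case 0
  then show ?case by simp
next
  case (Suc m)
  define X where "X p = a ^ p * commutator a h * a ^ (Suc m - p)" for p
  have "(\<Sum>p\<le>Suc m. commutator (a ^ Suc p) h * a ^ (Suc m - p)) =
      (\<Sum>p\<le>m. commutator (a ^ Suc p) h * a ^ (m - p)) * a + commutator (a ^ Suc (Suc m)) h"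
    unfolding sum.atMost_Suc sum_distrib_right
    by (intro arg_cong2[of _ _ _ _ "(+)"] sum.cong)
      (simp_all add: mult.assoc Suc_diff_le power_commutes del: power_Suc add: power_Suc2)
  also have "(\<Sum>p\<le>m. commutator (a ^ Suc p) h * a ^ (m - p)) * a = (\<Sum>p\<le>m. of_nat (Suc m - p) * X p)"
    unfolding Suc sum_distrib_right X_def
    by (intro sum.cong) (simp_all add: mult.assoc Suc_diff_le power_commutes)
  also have "\<dots> = (\<Sum>p\<le>Suc m. of_nat (Suc m - p) * X p)"
    by simp
  also have "commutator (a ^ Suc (Suc m)) h = (\<Sum>p\<le>Suc m. X p)"
    unfolding commutator_power_Suc X_def ..
  also have "(\<Sum>p\<le>Suc m. of_nat (Suc m - p) * X p) + (\<Sum>p\<le>Suc m. X p) =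
      (\<Sum>p\<le>Suc m. of_nat (Suc (Suc m) - p) * X p)"
    unfolding sum.distrib[symmetric]
    by (intro sum.cong) (auto simp: Suc_diff_le algebra_simps)
  finally show ?case
    by (simp only: X_def)
qed

section \<open>Multiplication operators\<close>

lemma op_power_L_op: "op_power (L_op a) n = L_op (a ^ n)"
  for a :: "'a::real_normed_algebra_1"
proof (induction n)
  case 0
  show ?case by (rule blinfun_eqI) (simp add: op_power_def)
next
  case (Suc n)
  have "op_power (L_op a) (Suc n) = L_op a o\<^sub>L op_power (L_op a) n"
    by (simp add: op_power_def)
  then show ?case
    by (auto intro!: blinfun_eqI simp: Suc mult.assoc power_commutes)
qed

lemma norm_L_op_le: "norm (L_op a) \<le> norm a"
  by (rule norm_blinfun_bound) (simp_all add: norm_mult_ineq mult.commute[of "norm a"])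

lemma norm_C_op_le: "norm (C_op a) \<le> 2 * norm a"
  using norm_commutator_le[of a]
  by (intro norm_blinfun_bound) (auto simp: C_op_apply commutator_def norm_minus_commute)

section \<open>Power series on a ball inside the disc of convergence\<close>

locale power_series_on_ball = unital_banach_algebra_over sA
  for sA :: "'k::{real_normed_field,banach} \<Rightarrow> 'a::{real_normed_algebra_1,banach} \<Rightarrow> 'a" +
  fixes \<alpha> :: "nat \<Rightarrow> 'k" and \<rho> :: real
  assumes \<rho>_pos: "0 < \<rho>" and \<rho>_less: "ereal \<rho> < conv_radius \<alpha>"
begin

text \<open>With \<open>G(t) = \<Sum>n. norm \<alpha>\<^sub>n * t^n\<close>, these are the terms of \<open>G'(\<rho>)\<close> and \<open>G''(\<rho>)\<close>; row \<open>m\<close> of the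
  triangular array has \<open>m + 1\<close> entries, and \<open>maj_comm m\<close> is the share of each entry in the
  \<open>m\<close>-th term of \<open>G''(\<rho>)\<close>.\<close>

definition maj1 :: "nat \<Rightarrow> real" where
  "maj1 n = diffs (\<lambda>n. norm (\<alpha> n)) n * \<rho> ^ n"

definition maj2 :: "nat \<Rightarrow> real" where
  "maj2 n = diffs (diffs (\<lambda>n. norm (\<alpha> n))) n * \<rho> ^ n"

definition maj_comm :: "nat \<Rightarrow> real" where
  "maj_comm m = of_nat (m + 2) * norm (\<alpha> (m + 2)) * \<rho> ^ m"

lemma maj1_eq: "maj1 n = of_nat (Suc n) * norm (\<alpha> (Suc n)) * \<rho> ^ n"
  by (simp add: maj1_def diffs_def)

lemma maj2_eq: "maj2 m = of_nat (Suc m) * maj_comm m"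
  by (simp add: maj2_def maj_comm_def diffs_def algebra_simps)

lemma maj1_nonneg [simp]: "0 \<le> maj1 n" and maj_comm_nonneg [simp]: "0 \<le> maj_comm n"
  and maj2_nonneg [simp]: "0 \<le> maj2 n"
  using \<rho>_pos by (auto simp: maj1_eq maj2_eq maj_comm_def)

lemma summable_maj1: "summable maj1" and summable_maj2: "summable maj2"
  using summable_diffs_norm(2,3)[OF less_imp_le[OF \<rho>_pos] \<rho>_less]
  by (auto simp: maj1_def[abs_def] maj2_def[abs_def])

lemma summable_triangle_maj_comm: "summable (\<lambda>m. \<Sum>p\<le>m. maj_comm m * K)"
  using summable_mult2[OF summable_maj2, of K] by (simp add: maj2_eq mult.assoc)

lemma scale_of_nat: "sA (of_nat k * c) v = sA c (of_nat k * v)"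
proof -
  have "sA (of_nat k) v = of_nat k * v"
    using scaleR_eq[of "of_nat k" v] by (simp add: scaleR_conv_of_real)
  then show ?thesis
    by (metis scale_scale mult.commute)
qed

lemma norm_scale_le: "norm (sA c v) \<le> norm c * b" if "norm v \<le> b"
  using that by (simp add: norm_scale mult_left_mono)

lemma scale_suminf: "summable f \<Longrightarrow> sA c (\<Sum>n. f n) = (\<Sum>n. sA c (f n))"
  by (rule bounded_linear.suminf[OF bounded_linear_scale])

section \<open>Termwise differentiation\<close>

text \<open>The term of index \<open>0\<close> of the power series is constant; the numbering starts at its successor, which
  avoids truncated exponents.\<close>

definition deriv_term :: "nat \<Rightarrow> 'a \<Rightarrow> 'a \<Rightarrow> 'a" where
  "deriv_term n a h = sA (\<alpha> (Suc n)) (power_deriv (Suc n) a h)"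

lemma norm_deriv_term_le:
  assumes "norm a \<le> \<rho>"
  shows "norm (deriv_term n a h) \<le> maj1 n * norm h"
  unfolding deriv_term_def
  using norm_scale_le[OF norm_power_deriv_le[OF assms, of "Suc n" h], of "\<alpha> (Suc n)"]
  by (simp add: maj1_eq mult_ac)

lemma summable_deriv_term:
  assumes "norm a \<le> \<rho>"
  shows "summable (\<lambda>n. deriv_term n a h)"
  by (rule summable_comparison_test'[OF summable_mult2[OF summable_maj1, of "norm h"], of 0])
    (rule norm_deriv_term_le[OF assms])

text \<open>Termwise differentiation needs the differentials to converge uniformly on a convex set, in
  operator norm. On the ball of radius \<open>\<rho>\<close> the tails of the majorant give this.\<close>

lemma has_derivative_power_series_map:
  assumes "norm a < \<rho>"
  shows "(power_series_map sA \<alpha> has_derivative (\<lambda>h. \<Sum>n. deriv_term n a h)) (at a)"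
proof -
  have a: "a \<in> ball 0 \<rho>" using assms by simp
  have deriv: "((\<lambda>x. sA (\<alpha> (Suc n)) (x ^ Suc n)) has_derivative deriv_term n x) (at x within ball 0 \<rho>)"
    for n x
    unfolding deriv_term_def[abs_def]
    by (rule bounded_linear.has_derivative[OF bounded_linear_scale has_derivative_power_deriv])
  have unif: "\<forall>\<^sub>F N in sequentially. \<forall>x\<in>ball 0 \<rho>. \<forall>h.
      norm ((\<Sum>n<N. deriv_term n x h) - (\<Sum>n. deriv_term n x h)) \<le> e * norm h" if e: "0 < e" for e
  proof -
    obtain N0 where N0: "\<And>N. N \<ge> N0 \<Longrightarrow> norm (\<Sum>i. maj1 (i + N)) < e"
      using suminf_exist_split[OF e summable_maj1] by blast
    show ?thesis
    proof (intro eventually_sequentiallyI[of N0] ballI allI)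
      fix N and x h :: 'a assume N: "N \<ge> N0" and "x \<in> ball 0 \<rho>"
      then have x: "norm x \<le> \<rho>" by simp
      have sd: "summable (\<lambda>i. maj1 (i + N))"
        by (rule summable_ignore_initial_segment[OF summable_maj1])
      have "norm ((\<Sum>n<N. deriv_term n x h) - (\<Sum>n. deriv_term n x h)) =
          norm (\<Sum>i. deriv_term (i + N) x h)"
        using suminf_split_initial_segment[OF summable_deriv_term[OF x], of h N]
        by simp
      also have "\<dots> \<le> (\<Sum>i. maj1 (i + N) * norm h)"
        by (rule norm_suminf_le [OF norm_deriv_term_le[OF x]]) (rule summable_mult2[OF sd])
      also have "\<dots> = (\<Sum>i. maj1 (i + N)) * norm h"
        by (rule suminf_mult2[OF sd, symmetric])
      also have "\<dots> \<le> e * norm h"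
        using N0[OF N] by (intro mult_right_mono) auto
      finally show "norm ((\<Sum>n<N. deriv_term n x h) - (\<Sum>n. deriv_term n x h)) \<le> e * norm h" .
    qed
  qed
  have sum0: "summable (\<lambda>n. sA (\<alpha> n) (x ^ n))" if "norm x \<le> \<rho>" for x :: 'a
  proof (rule summable_comparison_test'[OF summable_diffs_norm(1)[OF less_imp_le[OF \<rho>_pos] \<rho>_less], of 0])
    fix n
    show "norm (sA (\<alpha> n) (x ^ n)) \<le> norm (\<alpha> n) * \<rho> ^ n"
      using norm_power_ineq[of x n] power_mono[OF that norm_ge_zero, of n]
      by (intro norm_scale_le) linarith
  qed
  have shift: "(\<lambda>n. sA (\<alpha> (Suc n)) (x ^ Suc n)) sums (power_series_map sA \<alpha> x - sA (\<alpha> 0) 1)"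
    if "norm x \<le> \<rho>" for x :: 'a
    using summable_sums[OF sum0[OF that]] unfolding power_series_map_def
    using sums_Suc_iff[of "\<lambda>n. sA (\<alpha> n) (x ^ n)"] by simp
  obtain g where g: "\<And>x. x \<in> ball 0 \<rho> \<Longrightarrow> (\<lambda>n. sA (\<alpha> (Suc n)) (x ^ Suc n)) sums g x"
    and dg: "\<And>x. x \<in> ball 0 \<rho> \<Longrightarrow>
      (g has_derivative (\<lambda>h. \<Sum>n. deriv_term n x h)) (at x within ball 0 \<rho>)"
    using has_derivative_series[OF convex_ball deriv unif a shift[OF less_imp_le[OF assms]]] by blast
  have g_eq: "power_series_map sA \<alpha> x = g x + sA (\<alpha> 0) 1" if "x \<in> ball 0 \<rho>" for x
    using sums_unique2[OF g[OF that] shift] that by simp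
  have "((\<lambda>x. g x + sA (\<alpha> 0) 1) has_derivative (\<lambda>h. \<Sum>n. deriv_term n a h)) (at a within ball 0 \<rho>)"
    using has_derivative_add[OF dg[OF a] has_derivative_const] by simp
  then have "(power_series_map sA \<alpha> has_derivative (\<lambda>h. \<Sum>n. deriv_term n a h)) (at a within ball 0 \<rho>)"
    by (rule has_derivative_transform[OF a, rotated]) (rule g_eq)
  then show ?thesis
    using at_within_open[OF a open_ball] by simp
qed

lemma power_deriv_scale: "power_deriv n a (sA c h) = sA c (power_deriv n a h)"
  by (simp add: power_deriv_def scale_sum_right scale_mult_left scale_mult_right)

text \<open>The derivative obtained so far is only real-linear; linearity over the scalar field comes from the
  explicit terms.\<close>

lemma suminf_deriv_term_scale:
  assumes "norm a \<le> \<rho>"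
  shows "(\<Sum>n. deriv_term n a (sA c h)) = sA c (\<Sum>n. deriv_term n a h)"
  unfolding scale_suminf[OF summable_deriv_term[OF assms]]
  by (simp add: deriv_term_def power_deriv_scale mult.commute)

section \<open>The series of the elements\<close>

definition diag_term :: "'a \<Rightarrow> 'a \<Rightarrow> nat \<Rightarrow> 'a" where
  "diag_term a h n = sA (of_nat (Suc n) * \<alpha> (Suc n)) (h * a ^ n)"

text \<open>In \<open>comm_term a h m p\<close> the index is \<open>m = n - 2\<close>, so that row \<open>m\<close> of the array
  belongs to the coefficient \<open>\<alpha>\<^sub>n\<close>.\<close>

definition comm_term :: "'a \<Rightarrow> 'a \<Rightarrow> nat \<Rightarrow> nat \<Rightarrow> 'a" where
  "comm_term a h m p = sA (of_nat (Suc m - p) * \<alpha> (m + 2)) (a ^ p * commutator a h * a ^ (m - p))"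

lemma norm_diag_term_le:
  assumes "norm a \<le> \<rho>" "norm h \<le> M"
  shows "norm (diag_term a h n) \<le> maj1 n * M"
  using norm_scale_le[of "h * a ^ n" "\<rho> ^ n * M" "of_nat (Suc n) * \<alpha> (Suc n)"]
    norm_sandwich_le[OF assms, of 0 n]
  unfolding diag_term_def by (simp add: maj1_eq norm_mult mult_ac del: of_nat_Suc)

lemma norm_comm_term_le:
  assumes "norm a \<le> \<rho>" "norm h \<le> M" "p \<le> m"
  shows "norm (comm_term a h m p) \<le> maj_comm m * (2 * \<rho> * M)"
proof -
  have "norm (commutator a h) \<le> 2 * norm a * norm h"
    by (rule norm_commutator_le)
  also have "\<dots> \<le> 2 * \<rho> * M"
    using assms \<rho>_pos by (intro mult_mono) auto
  finally have "norm (a ^ p * commutator a h * a ^ (m - p)) \<le> \<rho> ^ m * (2 * \<rho> * M)" (is "?v \<le> ?b")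
    using norm_sandwich_le[OF assms(1), of "commutator a h" "2 * \<rho> * M" p "m - p"] assms(3) by simp
  then have "norm (comm_term a h m p) \<le> norm (of_nat (Suc m - p) * \<alpha> (m + 2)) * ?b"
    unfolding comm_term_def by (rule norm_scale_le)
  also have "\<dots> \<le> of_nat (m + 2) * norm (\<alpha> (m + 2)) * ?b"
    unfolding norm_mult norm_of_nat using \<rho>_pos order_trans[OF norm_ge_zero assms(2)]
    by (intro mult_right_mono of_nat_mono mult_nonneg_nonneg) auto
  finally show ?thesis by (simp only: maj_comm_def mult_ac)
qed

lemma norm_sum_comm_term_le:
  assumes "norm a \<le> \<rho>" "norm h \<le> M"
  shows "norm (\<Sum>p\<le>m. comm_term a h m p) \<le> maj2 m * (2 * \<rho> * M)"
proof -
  have "norm (\<Sum>p\<le>m. comm_term a h m p) \<le> (\<Sum>p\<le>m. maj_comm m * (2 * \<rho> * M))"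
    by (rule sum_norm_le) (simp add: norm_comm_term_le[OF assms])
  then show ?thesis by (simp add: maj2_eq mult.assoc)
qed

lemma summable_diag_term: "norm a \<le> \<rho> \<Longrightarrow> summable (diag_term a h)"
  by (rule summable_comparison_test'[OF summable_mult2[OF summable_maj1], of 0])
    (rule norm_diag_term_le[OF _ order_refl])

lemma summable_sum_comm_term: "norm a \<le> \<rho> \<Longrightarrow> summable (\<lambda>m. \<Sum>p\<le>m. comm_term a h m p)"
  by (rule summable_comparison_test'[OF summable_mult2[OF summable_maj2], of 0])
    (rule norm_sum_comm_term_le[OF _ order_refl])

lemma assumes "0 \<le> K"
  shows summable_maj_comm_column: "summable (\<lambda>n. maj_comm (n + p) * K)"
    and summable_maj_comm_columns: "summable (\<lambda>p. \<Sum>n. maj_comm (n + p) * K)"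
  using triangle_sums(1,2)[of "\<lambda>m p. 0 :: real" "\<lambda>m p. maj_comm m * K",
      OF _ summable_triangle_maj_comm] assms
  by simp_all

lemma column_nonneg: "0 \<le> (\<Sum>n. maj_comm (n + p) * K)" if "0 \<le> K"
  using that by (intro suminf_nonneg summable_maj_comm_column) auto

text \<open>The series splits term by term; the term with index \<open>0\<close> has no commutators, which accounts for the
  shift between the two series on the right.\<close>

lemma suminf_deriv_term:
  assumes "norm a \<le> \<rho>"
  shows "(\<Sum>n. deriv_term n a h) = (\<Sum>n. diag_term a h n) + (\<Sum>m. \<Sum>p\<le>m. comm_term a h m p)"
proof -
  have 0: "deriv_term 0 a h = diag_term a h 0"
    by (simp add: deriv_term_def diag_term_def power_deriv_def)
  have S: "deriv_term (Suc m) a h = diag_term a h (Suc m) + (\<Sum>p\<le>m. comm_term a h m p)" for m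
    using power_deriv_eq_commutators[of m a h]
    by (simp add: deriv_term_def diag_term_def comm_term_def scale_of_nat scale_right_distrib
        sum_commutator_powers scale_sum_right del: of_nat_Suc power_Suc of_nat_diff)
  note sd = summable_diag_term[OF assms, of h]
  have "(\<Sum>n. deriv_term n a h) = deriv_term 0 a h + (\<Sum>n. deriv_term (Suc n) a h)"
    using suminf_split_head[OF summable_deriv_term[OF assms]] by simp
  also have "(\<Sum>n. deriv_term (Suc n) a h) =
      (\<Sum>n. diag_term a h (Suc n)) + (\<Sum>m. \<Sum>p\<le>m. comm_term a h m p)"
    unfolding S using sd
    by (intro suminf_add[symmetric] summable_sum_comm_term assms) (simp add: summable_Suc_iff)
  finally show ?thesis
    using suminf_split_head[OF sd] by (simp add: 0)
qed

lemma comm_columns_sums: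
  assumes "norm a \<le> \<rho>"
  shows "(\<lambda>p. \<Sum>n. comm_term a h (n + p) p) sums (\<Sum>m. \<Sum>p\<le>m. comm_term a h m p)"
  by (rule triangle_sums(3)[OF norm_comm_term_le[OF assms order_refl] summable_triangle_maj_comm])

lemma summable_comm_column:
  assumes "norm a \<le> \<rho>"
  shows "summable (\<lambda>n. comm_term a h (n + p) p)"
  by (rule summable_comparison_test'[OF summable_maj_comm_column, of "2 * \<rho> * norm h" 0])
    (use \<rho>_pos in \<open>auto intro: norm_comm_term_le[OF assms order_refl]\<close>)

lemma norm_comm_column_le:
  assumes "norm a \<le> \<rho>" "norm h \<le> M"
  shows "norm (\<Sum>n. comm_term a h (n + p) p) \<le> (\<Sum>n. maj_comm (n + p) * (2 * \<rho> * M))"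
  using \<rho>_pos order_trans[OF norm_ge_zero assms(2)]
  by (intro norm_suminf_le norm_comm_term_le[OF assms] summable_maj_comm_column) auto

section \<open>The series of the operators\<close>

lemma norm_op_scale: "norm (op_scale sA c U) \<le> norm c * norm U"
  by (rule norm_blinfun_bound)
    (auto simp: op_scale_apply mult.assoc intro!: norm_scale_le norm_blinfun)

definition op_diag_term :: "'a \<Rightarrow> ('x::real_normed_vector \<Rightarrow>\<^sub>L 'a) \<Rightarrow> nat \<Rightarrow> 'x \<Rightarrow>\<^sub>L 'a" where
  "op_diag_term a S n = op_scale sA (of_nat (Suc n) * \<alpha> (Suc n)) (L_op (a ^ n) o\<^sub>L S)"

definition op_comm_term :: "'a \<Rightarrow> ('x::real_normed_vector \<Rightarrow>\<^sub>L 'a) \<Rightarrow> nat \<Rightarrow> nat \<Rightarrow> 'x \<Rightarrow>\<^sub>L 'a" where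
  "op_comm_term a S m p =
    op_scale sA (\<alpha> (m + 2)) (L_op (a ^ (m - p))) o\<^sub>L C_op (a ^ Suc p) o\<^sub>L S"

lemma op_diag_term_apply: "blinfun_apply (op_diag_term a S n) h = diag_term a (S h) n"
  by (simp add: op_diag_term_def op_scale_apply diag_term_def)

lemma norm_op_diag_term_le:
  assumes "norm a \<le> \<rho>" "norm S \<le> M"
  shows "norm (op_diag_term a S n) \<le> maj1 n * M"
proof (rule norm_blinfun_bound)
  show "0 \<le> maj1 n * M" using order_trans[OF norm_ge_zero assms(2)] by simp
  fix h
  have "norm (S h) \<le> M * norm h"
    using norm_blinfun[of S h] assms(2) by (meson mult_right_mono norm_ge_zero order_trans)
  from norm_diag_term_le[OF assms(1) this]
  show "norm (op_diag_term a S n h) \<le> maj1 n * M * norm h"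
    by (simp add: op_diag_term_apply mult.assoc)
qed

lemma norm_power_le: "norm (a ^ n) \<le> \<rho> ^ n" if "norm a \<le> \<rho>" for a :: 'a
  using norm_sandwich_le[OF that, of 1 1 n 0] by simp

lemma norm_op_comm_term_le:
  assumes "norm a \<le> \<rho>" "norm S \<le> M" "p \<le> m"
  shows "norm (op_comm_term a S m p) \<le> maj_comm m * (2 * \<rho> * M)"
proof -
  have M: "0 \<le> M" using order_trans[OF norm_ge_zero assms(2)] .
  have "norm (op_scale sA (\<alpha> (m + 2)) (L_op (a ^ (m - p)))) \<le> norm (\<alpha> (m + 2)) * \<rho> ^ (m - p)"
    by (meson norm_op_scale norm_L_op_le norm_power_le[OF assms(1)] order_trans mult_left_mono norm_ge_zero)
  moreover have "norm (C_op (a ^ Suc p)) \<le> 2 * \<rho> ^ Suc p"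
    using norm_C_op_le[of "a ^ Suc p"] norm_power_le[OF assms(1), of "Suc p"] by linarith
  ultimately have "norm (op_comm_term a S m p) \<le>
      norm (\<alpha> (m + 2)) * \<rho> ^ (m - p) * (2 * \<rho> ^ Suc p) * M"
    unfolding op_comm_term_def using \<rho>_pos assms(2)
    by (intro order_trans[OF norm_blinfun_compose] mult_mono) auto
  also have "\<dots> = norm (\<alpha> (m + 2)) * (\<rho> ^ (m - p) * \<rho> ^ p) * (2 * \<rho> * M)"
    by simp
  also have "\<rho> ^ (m - p) * \<rho> ^ p = \<rho> ^ m"
    using assms(3) by (simp flip: power_add)
  also have "norm (\<alpha> (m + 2)) * \<rho> ^ m * (2 * \<rho> * M) \<le> maj_comm m * (2 * \<rho> * M)"
    unfolding maj_comm_def using \<rho>_pos M mult_right_mono[of 1 "real (m + 2)" "norm (\<alpha> (m + 2))"]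
    by (intro mult_right_mono) auto
  finally show ?thesis .
qed

lemma norm_coeff_op_le:
  assumes "norm a \<le> \<rho>"
  shows "norm (op_scale sA (\<alpha> (n + k)) (L_op (a ^ n))) \<le> norm (\<alpha> (n + k)) * \<rho> ^ n"
  by (meson norm_op_scale norm_L_op_le norm_power_le[OF assms] order_trans mult_left_mono norm_ge_zero)

lemma summable_shifted_coeffs: "summable (\<lambda>n. norm (\<alpha> (n + k)) * \<rho> ^ n)"
proof -
  have "summable (\<lambda>n. norm (\<alpha> (n + k)) * \<rho> ^ (n + k) / \<rho> ^ k)"
    using summable_diffs_norm(1)[OF less_imp_le[OF \<rho>_pos] \<rho>_less]
    by (intro summable_divide summable_ignore_initial_segment)
  then show ?thesis
    using \<rho>_pos by (simp add: power_add)
qed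

lemma summable_coeff_op:
  assumes "norm a \<le> \<rho>"
  shows "summable (\<lambda>n. op_scale sA (\<alpha> (n + k)) (L_op (a ^ n)))"
  by (rule summable_comparison_test'[OF summable_shifted_coeffs[of k], of 0]) (rule norm_coeff_op_le[OF assms])

text \<open>The inner series of part (2), composed with the operators to its right, is a column of a triangular
  array of operators, with \<open>k = p + 2\<close>. Composition is continuous, so it may be taken inside the series.\<close>

lemma suminf_op_comm_column:
  assumes "norm a \<le> \<rho>"
  shows "(\<Sum>n. op_scale sA (\<alpha> (n + (p + 2))) (L_op (a ^ n))) o\<^sub>L C_op (a ^ Suc p) o\<^sub>L S =
    (\<Sum>n. op_comm_term a S (n + p) p)"
proof -
  have "bounded_linear (\<lambda>U. U o\<^sub>L C_op (a ^ Suc p) o\<^sub>L S)"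
    by (intro bounded_linear_intros)
  from bounded_linear.suminf[OF this summable_coeff_op[OF assms, of "p + 2"]]
  show ?thesis by (simp add: op_comm_term_def add.assoc)
qed

lemma op_comm_columns_sums:
  assumes "norm a \<le> \<rho>"
  shows "(\<lambda>p. \<Sum>n. op_comm_term a S (n + p) p) sums (\<Sum>m. \<Sum>p\<le>m. op_comm_term a S m p)"
  by (rule triangle_sums(3)[OF norm_op_comm_term_le[OF assms order_refl] summable_triangle_maj_comm])

lemma norm_op_comm_column_le:
  assumes "norm a \<le> \<rho>" "norm S \<le> M"
  shows "norm (\<Sum>n. op_comm_term a S (n + p) p) \<le> (\<Sum>n. maj_comm (n + p) * (2 * \<rho> * M))"
  using \<rho>_pos order_trans[OF norm_ge_zero assms(2)]
  by (intro norm_suminf_le norm_op_comm_term_le[OF assms] summable_maj_comm_column) auto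

lemma summable_op_diag_term: "norm a \<le> \<rho> \<Longrightarrow> summable (op_diag_term a S)"
  by (rule summable_comparison_test'[OF summable_mult2[OF summable_maj1], of 0])
    (rule norm_op_diag_term_le[OF _ order_refl])

lemma summable_sum_op_comm_term:
  assumes "norm a \<le> \<rho>"
  shows "summable (\<lambda>m. \<Sum>p\<le>m. op_comm_term a S m p)"
  by (rule summable_comparison_test'[OF summable_triangle_maj_comm, of 0])
    (rule sum_norm_le, rule norm_op_comm_term_le[OF assms order_refl], simp)

text \<open>Row by row, the operators of part (2) agree with the commutators of part (1) up to sign; single
  entries do not, as the coefficients \<open>m + 1 - p\<close> appear only after summation over a row.\<close>

lemma sum_op_comm_term_apply:
  "blinfun_apply (\<Sum>p\<le>m. op_comm_term a S m p) h = - (\<Sum>p\<le>m. comm_term a (S h) m p)"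
proof -
  have "op_comm_term a S m p h =
      - sA (\<alpha> (m + 2)) (commutator (a ^ Suc p) (S h) * a ^ (m - p))" for p
    by (simp add: op_comm_term_def op_scale_apply C_op_apply commutator_def algebra_simps
        flip: scale_minus_right)
  then have "blinfun_apply (\<Sum>p\<le>m. op_comm_term a S m p) h =
      - sA (\<alpha> (m + 2)) (\<Sum>p\<le>m. commutator (a ^ Suc p) (S h) * a ^ (m - p))"
    by (simp add: blinfun.sum_left sum_negf scale_sum_right)
  then show ?thesis
    unfolding sum_commutator_powers
    by (simp add: comm_term_def scale_of_nat scale_sum_right del: of_nat_Suc of_nat_diff)
qed

lemma suminf_op_apply:
  assumes "norm a \<le> \<rho>"
  shows "blinfun_apply ((\<Sum>n. op_diag_term a S n) - (\<Sum>p. \<Sum>n. op_comm_term a S (n + p) p)) h =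
    (\<Sum>n. deriv_term n a (S h))"
proof -
  note apply_suminf = bounded_linear.suminf[OF blinfun.bounded_linear_left, of _ h]
  have "blinfun_apply (\<Sum>n. op_diag_term a S n) h = (\<Sum>n. diag_term a (S h) n)"
    by (simp add: apply_suminf[OF summable_op_diag_term[OF assms]] op_diag_term_apply)
  moreover have "blinfun_apply (\<Sum>m. \<Sum>p\<le>m. op_comm_term a S m p) h =
      - (\<Sum>m. \<Sum>p\<le>m. comm_term a (S h) m p)"
    by (simp add: apply_suminf[OF summable_sum_op_comm_term[OF assms]] sum_op_comm_term_apply
        suminf_minus[OF summable_sum_comm_term[OF assms]])
  ultimately show ?thesis
    using sums_unique[OF op_comm_columns_sums[OF assms, of S]]
    by (simp add: blinfun.diff_left suminf_deriv_term[OF assms])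
qed

end

section \<open>The differential of a power series along a differentiable map\<close>

theorem mainTheorem4:
  fixes sA :: "'k::{real_normed_field,banach} \<Rightarrow> 'a::{real_normed_algebra_1,banach} \<Rightarrow> 'a"
    and sX :: "'k \<Rightarrow> 'x::banach \<Rightarrow> 'x"
    and \<alpha> :: "nat \<Rightarrow> 'k" and R rt :: ereal and r :: real
    and D :: "'x set" and T :: "'x \<Rightarrow> 'a"
  assumes A: "unital_banach_algebra_over sA"
    and X: "banach_space_over sX"
    and R: "conv_radius \<alpha> = R" "0 < R"
    and r: "0 < r" "ereal r < R"
    and D: "open D"
    and T: "frechet_differentiable_over sX sA T D"
    and alternatives: "T ` D \<subseteq> ball 0 r \<or>
      (convex D \<and> bounded D \<and> (SUP x\<in>D. ereal (norm (fdifferential T x))) < \<infinity>)"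
    and rt: "rt = (SUP x\<in>D. ereal (norm (T x)))" "0 < rt" "rt < R"
  shows
    \<comment> \<open>Part (1)\<close>
    "frechet_differentiable_over sX sA (power_series_map sA \<alpha> \<circ> T) D \<and>
     (\<forall>x\<in>D. \<forall>h.
        series_converges_from 1
          (\<lambda>n. sA (of_nat n * \<alpha> n) (fdifferential T x h * T x ^ (n - 1))) \<and>
        series_converges_from 2
          (\<lambda>n. \<Sum>p = 0..n - 2. sA (of_nat (n - p - 1) * \<alpha> n)
             (T x ^ p * commutator (T x) (fdifferential T x h) * T x ^ (n - (2 + p)))) \<and>
        (\<forall>p. series_converges_from (p + 2)
          (\<lambda>n. sA (of_nat (n - p - 1) * \<alpha> n)
             (T x ^ p * commutator (T x) (fdifferential T x h) * T x ^ (n - (2 + p))))) \<and>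
        series_converges_from 0
          (\<lambda>p. series_from (p + 2)
             (\<lambda>n. sA (of_nat (n - p - 1) * \<alpha> n)
               (T x ^ p * commutator (T x) (fdifferential T x h) * T x ^ (n - (2 + p))))) \<and>
        fdifferential (power_series_map sA \<alpha> \<circ> T) x h =
          series_from 1 (\<lambda>n. sA (of_nat n * \<alpha> n) (fdifferential T x h * T x ^ (n - 1))) +
          series_from 2 (\<lambda>n. \<Sum>p = 0..n - 2. sA (of_nat (n - p - 1) * \<alpha> n)
             (T x ^ p * commutator (T x) (fdifferential T x h) * T x ^ (n - (2 + p)))) \<and>
        fdifferential (power_series_map sA \<alpha> \<circ> T) x h =
          series_from 1 (\<lambda>n. sA (of_nat n * \<alpha> n) (fdifferential T x h * T x ^ (n - 1))) +
          series_from 0 (\<lambda>p. series_from (p + 2) (\<lambda>n. sA (of_nat (n - p - 1) * \<alpha> n)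
             (T x ^ p * commutator (T x) (fdifferential T x h) * T x ^ (n - (2 + p)))))) \<and>
     ((SUP x\<in>D. ereal (norm (fdifferential T x))) < \<infinity> \<longrightarrow>
        (\<forall>L>0.
          abs_unif_convergent_from 1 (D \<times> ball 0 L)
            (\<lambda>n (x, h). sA (of_nat n * \<alpha> n) (fdifferential T x h * T x ^ (n - 1))) \<and>
          abs_unif_convergent_from 2 (D \<times> ball 0 L)
            (\<lambda>n (x, h). \<Sum>p = 0..n - 2. sA (of_nat (n - p - 1) * \<alpha> n)
               (T x ^ p * commutator (T x) (fdifferential T x h) * T x ^ (n - (2 + p)))) \<and>
          (\<forall>p. abs_unif_convergent_from (p + 2) (D \<times> ball 0 L)
            (\<lambda>n (x, h). sA (of_nat (n - p - 1) * \<alpha> n)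
               (T x ^ p * commutator (T x) (fdifferential T x h) * T x ^ (n - (2 + p))))) \<and>
          abs_unif_convergent_from 0 (D \<times> ball 0 L)
            (\<lambda>p (x, h). series_from (p + 2) (\<lambda>n. sA (of_nat (n - p - 1) * \<alpha> n)
               (T x ^ p * commutator (T x) (fdifferential T x h) * T x ^ (n - (2 + p))))))) \<and>
    \<comment> \<open>Part (2)\<close>
     (\<forall>x\<in>D.
        series_converges_from 1
          (\<lambda>n. op_scale sA (of_nat n * \<alpha> n) (op_power (L_op (T x)) (n - 1) o\<^sub>L fdifferential T x)) \<and>
        (\<forall>k\<ge>2. series_converges_from k
          (\<lambda>n. op_scale sA (\<alpha> n) (op_power (L_op (T x)) (n - k)))) \<and>
        series_converges_from 2
          (\<lambda>k. series_from k (\<lambda>n. op_scale sA (\<alpha> n) (op_power (L_op (T x)) (n - k)))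
                 o\<^sub>L C_op (T x ^ (k - 1)) o\<^sub>L fdifferential T x) \<and>
        fdifferential (power_series_map sA \<alpha> \<circ> T) x =
          series_from 1
            (\<lambda>n. op_scale sA (of_nat n * \<alpha> n) (op_power (L_op (T x)) (n - 1) o\<^sub>L fdifferential T x)) -
          series_from 2
            (\<lambda>k. series_from k (\<lambda>n. op_scale sA (\<alpha> n) (op_power (L_op (T x)) (n - k)))
                   o\<^sub>L C_op (T x ^ (k - 1)) o\<^sub>L fdifferential T x)) \<and>
     ((SUP x\<in>D. ereal (norm (fdifferential T x))) < \<infinity> \<longrightarrow>
        abs_unif_convergent_from 1 D
          (\<lambda>n x. op_scale sA (of_nat n * \<alpha> n) (op_power (L_op (T x)) (n - 1) o\<^sub>L fdifferential T x)) \<and>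
        (\<forall>k\<ge>2. abs_unif_convergent_from k D
          (\<lambda>n x. op_scale sA (\<alpha> n) (op_power (L_op (T x)) (n - k)))) \<and>
        abs_unif_convergent_from 2 D
          (\<lambda>k x. series_from k (\<lambda>n. op_scale sA (\<alpha> n) (op_power (L_op (T x)) (n - k)))
                   o\<^sub>L C_op (T x ^ (k - 1)) o\<^sub>L fdifferential T x))"
proof -
  obtain \<rho> where \<rho>: "rt < ereal \<rho>" "ereal \<rho> < R"
    using ereal_dense2[OF rt(3)] by blast
  interpret power_series_on_ball sA \<alpha> \<rho>
  proof (intro power_series_on_ball.intro power_series_on_ball_axioms.intro A)
    show "0 < \<rho>" using less_trans[OF rt(2) \<rho>(1)] by simp
    show "ereal \<rho> < conv_radius \<alpha>" using \<rho>(2) R(1) by simp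
  qed
  have less: "norm (T x) < \<rho>" if "x \<in> D" for x
  proof -
    have "ereal (norm (T x)) \<le> rt" unfolding rt(1) using that by (rule SUP_upper)
    then show ?thesis using \<rho>(1) by (metis le_less_trans ereal_less(2) ereal_less_eq(3) less_ereal.simps(1))
  qed
  then have le: "norm (T x) \<le> \<rho>" if "x \<in> D" for x
    using that less_imp_le by blast
  let ?T' = "fdifferential T"
  have T': "Vector_Spaces.linear sX sA (?T' x)" "(T has_derivative ?T' x) (at x)" if "x \<in> D" for x
    using T that fdifferential_eq unfolding frechet_differentiable_over_def by metis+

  have chain: "(power_series_map sA \<alpha> \<circ> T has_derivative (\<lambda>h. \<Sum>n. deriv_term n (T x) (?T' x h))) (at x)"
    if "x \<in> D" for x
    using diff_chain_at[OF T'(2)[OF that] has_derivative_power_series_map[OF less[OF that]]]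
    by (simp add: comp_def)
  \<comment> \<open>Defining the differential by the operator formula makes its continuity automatic.\<close>
  define G where "G x = (\<Sum>n. op_diag_term (T x) (?T' x) n)
      - (\<Sum>p. \<Sum>n. op_comm_term (T x) (?T' x) (n + p) p)" for x
  have G_apply: "blinfun_apply (G x) h = (\<Sum>n. deriv_term n (T x) (?T' x h))" if "x \<in> D" for x h
    unfolding G_def by (rule suminf_op_apply[OF le[OF that]])
  have G: "(power_series_map sA \<alpha> \<circ> T has_derivative G x) (at x)" if "x \<in> D" for x
    using chain[OF that] by (simp add: G_apply[OF that, abs_def])
  have G_linear: "Vector_Spaces.linear sX sA (G x)" if "x \<in> D" for x
    unfolding Vector_Spaces.linear_iff
  proof (intro conjI allI)
    fix c h
    have "?T' x (sX c h) = sA c (?T' x h)"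
      using T'(1)[OF that] unfolding Vector_Spaces.linear_iff by blast
    then show "G x (sX c h) = sA c (G x h)"
      by (simp add: G_apply[OF that] suminf_deriv_term_scale[OF le[OF that]])
  qed (use X[unfolded banach_space_over_def normed_space_over_def] vector_space_axioms
      in \<open>auto simp: blinfun.add_right\<close>)
  have diff: "frechet_differentiable_over sX sA (power_series_map sA \<alpha> \<circ> T) D"
    unfolding frechet_differentiable_over_def using G G_linear by blast
  have G_eq: "fdifferential (power_series_map sA \<alpha> \<circ> T) x = G x" if "x \<in> D" for x
    by (rule fdifferential_eq[OF G[OF that]])

  \<comment> \<open>Starting each series at its first index turns the terms into those of the two arrays.\<close>
  let ?S1 = "\<lambda>a h n. sA (of_nat n * \<alpha> n) (h * a ^ (n - 1))"
  let ?S2 = "\<lambda>a h p n. sA (of_nat (n - p - 1) * \<alpha> n) (a ^ p * commutator a h * a ^ (n - (2 + p)))"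
  have S1: "?S1 a h (n + 1) = diag_term a h n" for a h n
    by (simp add: diag_term_def)
  have S2: "(\<Sum>p = 0..n + 2 - 2. ?S2 a h p (n + 2)) = (\<Sum>p\<le>n. comm_term a h n p)" for a h n
    by (simp add: comm_term_def atLeast0AtMost Suc_diff_le)
  have S3: "?S2 a h p (n + (p + 2)) = comm_term a h (n + p) p" for a h p n
    by (simp add: comm_term_def add.assoc)
  have S4: "series_from (p + 2) (?S2 a h p) = (\<Sum>n. comm_term a h (n + p) p)" for a h p
    unfolding series_from_def S3 ..
  let ?P1 = "\<lambda>(a::'a) (S :: 'x \<Rightarrow>\<^sub>L 'a) n. op_scale sA (of_nat n * \<alpha> n) (op_power (L_op a) (n - 1) o\<^sub>L S)"
  let ?P2 = "\<lambda>(a::'a) k n. op_scale sA (\<alpha> n) (op_power (L_op a) (n - k))"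
  let ?P3 = "\<lambda>(a::'a) (S :: 'x \<Rightarrow>\<^sub>L 'a) k. series_from k (?P2 a k) o\<^sub>L C_op (a ^ (k - 1)) o\<^sub>L S"
  have P1: "?P1 a S (n + 1) = op_diag_term a S n" for a S n
    by (simp add: op_diag_term_def op_power_L_op)
  have P2: "?P2 a k (n + k) = op_scale sA (\<alpha> (n + k)) (L_op (a ^ n))" for a k n
    by (simp add: op_power_L_op)
  have P3: "?P3 a S (p + 2) = (\<Sum>n. op_comm_term a S (n + p) p)" if "norm a \<le> \<rho>" for a S p
    unfolding series_from_def P2 using suminf_op_comm_column[OF that, of p S] by simp

  have pointwise1: "series_converges_from 1 (?S1 a h)"
    "series_converges_from 2 (\<lambda>n. \<Sum>p = 0..n - 2. ?S2 a h p n)"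
    "series_converges_from (p + 2) (?S2 a h p)"
    "series_converges_from 0 (\<lambda>p. series_from (p + 2) (?S2 a h p))"
    "(\<Sum>n. deriv_term n a h) = series_from 1 (?S1 a h) + series_from 2 (\<lambda>n. \<Sum>p = 0..n - 2. ?S2 a h p n)"
    "(\<Sum>n. deriv_term n a h) = series_from 1 (?S1 a h) + series_from 0 (\<lambda>p. series_from (p + 2) (?S2 a h p))"
    if a: "norm a \<le> \<rho>" for a h p
    unfolding S4 unfolding series_converges_from_def series_from_def S1 S2 S3 add_0_right
    using summable_diag_term[OF a] summable_sum_comm_term[OF a] summable_comm_column[OF a]
      comm_columns_sums[OF a, of h] suminf_deriv_term[OF a, of h]
    by (auto simp: sums_iff)

  have pointwise2: "series_converges_from 1 (?P1 a S)"
    "series_converges_from k (?P2 a k)"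
    "series_converges_from 2 (?P3 a S)"
    "series_from 1 (?P1 a S) = (\<Sum>n. op_diag_term a S n)"
    "series_from 2 (?P3 a S) = (\<Sum>p. \<Sum>n. op_comm_term a S (n + p) p)"
    if a: "norm a \<le> \<rho>" for a S k
    unfolding series_converges_from_def series_from_def[of 1] series_from_def[of 2 "?P3 a S"]
      P1 P2 P3[OF a]
    using summable_op_diag_term[OF a] summable_coeff_op[OF a] op_comm_columns_sums[OF a, of S]
    by (auto simp: sums_iff)

  have unif1: "(\<forall>L>0.
          abs_unif_convergent_from 1 (D \<times> ball 0 L) (\<lambda>n (x, h). ?S1 (T x) (?T' x h) n) \<and>
          abs_unif_convergent_from 2 (D \<times> ball 0 L)
            (\<lambda>n (x, h). \<Sum>p = 0..n - 2. ?S2 (T x) (?T' x h) p n) \<and>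
          (\<forall>p. abs_unif_convergent_from (p + 2) (D \<times> ball 0 L)
            (\<lambda>n (x, h). ?S2 (T x) (?T' x h) p n)) \<and>
          abs_unif_convergent_from 0 (D \<times> ball 0 L)
            (\<lambda>p (x, h). series_from (p + 2) (?S2 (T x) (?T' x h) p)))"
      (is ?U1)
    and unif2: "abs_unif_convergent_from 1 D (\<lambda>n x. ?P1 (T x) (?T' x) n) \<and>
        (\<forall>k\<ge>2. abs_unif_convergent_from k D (\<lambda>n x. ?P2 (T x) k n)) \<and>
        abs_unif_convergent_from 2 D (\<lambda>k x. ?P3 (T x) (?T' x) k)"
      (is ?U2)
    if bdd: "(SUP x\<in>D. ereal (norm (?T' x))) < \<infinity>"
  proof -
    obtain N where N: "0 \<le> N" "\<And>x. x \<in> D \<Longrightarrow> norm (?T' x) \<le> N"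
    proof -
      obtain N where "(SUP x\<in>D. ereal (norm (?T' x))) < ereal N"
        using bdd less_PInf_Ex_of_nat by auto
      then have "norm (?T' x) \<le> N" if "x \<in> D" for x
        using SUP_upper[OF that, of "\<lambda>x. ereal (norm (?T' x))"]
        by (metis ereal_less_eq(3) order_trans less_imp_le)
      then show thesis by (intro that[of "max 0 N"]) (auto simp: le_max_iff_disj)
    qed
    note \<rho>0 = less_imp_le[OF \<rho>_pos]
    show ?U1
    proof (intro allI impI conjI)
      fix L :: real assume "0 < L"
      with N(1) have M0: "0 \<le> N * L" by simp
      then have K0: "0 \<le> 2 * \<rho> * (N * L)" using \<rho>0 by simp
      have M: "norm (?T' x h) \<le> N * L" if "(x, h) \<in> D \<times> ball 0 L" for x h
        using that N by (intro order_trans[OF norm_blinfun] mult_mono) auto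
      show "abs_unif_convergent_from 1 (D \<times> ball 0 L) (\<lambda>n (x, h). ?S1 (T x) (?T' x h) n)"
        by (rule abs_unif_convergent_fromI[OF _ summable_mult2[OF summable_maj1, of "N * L"]])
          (auto simp only: S1 split_beta mem_Times_iff fst_conv snd_conv
            intro!: norm_diag_term_le le M M0 mult_nonneg_nonneg maj1_nonneg)
      show "abs_unif_convergent_from 2 (D \<times> ball 0 L)
            (\<lambda>n (x, h). \<Sum>p = 0..n - 2. ?S2 (T x) (?T' x h) p n)"
        by (rule abs_unif_convergent_fromI[OF _ summable_mult2[OF summable_maj2, of "2 * \<rho> * (N * L)"]])
          (auto simp only: S2 split_beta mem_Times_iff fst_conv snd_conv
            intro!: norm_sum_comm_term_le le M K0 mult_nonneg_nonneg maj2_nonneg)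
      show "abs_unif_convergent_from (p + 2) (D \<times> ball 0 L) (\<lambda>n (x, h). ?S2 (T x) (?T' x h) p n)" for p
        by (rule abs_unif_convergent_fromI[OF _ summable_maj_comm_column[OF K0, of p]])
          (auto simp only: S3 split_beta mem_Times_iff fst_conv snd_conv
            intro!: norm_comm_term_le le M K0 mult_nonneg_nonneg maj_comm_nonneg le_add2)
      show "abs_unif_convergent_from 0 (D \<times> ball 0 L)
            (\<lambda>p (x, h). series_from (p + 2) (?S2 (T x) (?T' x h) p))"
        by (rule abs_unif_convergent_fromI[OF _ summable_maj_comm_columns[OF K0]])
          (auto simp only: S4 add_0_right split_beta mem_Times_iff fst_conv snd_conv
            intro!: norm_comm_column_le le M K0 column_nonneg)
    qed
    have K0: "0 \<le> 2 * \<rho> * N" using \<rho>0 N(1) by simp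
    show ?U2
    proof (intro allI impI conjI)
      show "abs_unif_convergent_from 1 D (\<lambda>n x. ?P1 (T x) (?T' x) n)"
        by (rule abs_unif_convergent_fromI[OF _ summable_mult2[OF summable_maj1, of N]])
          (auto simp only: P1
            intro!: norm_op_diag_term_le le N mult_nonneg_nonneg maj1_nonneg)
      show "abs_unif_convergent_from k D (\<lambda>n x. ?P2 (T x) k n)" for k
        by (rule abs_unif_convergent_fromI[OF _ summable_shifted_coeffs[of k]])
          (auto simp only: P2
            intro!: norm_coeff_op_le le mult_nonneg_nonneg norm_ge_zero zero_le_power \<rho>0)
      show "abs_unif_convergent_from 2 D (\<lambda>k x. ?P3 (T x) (?T' x) k)"
        by (rule abs_unif_convergent_fromI[OF _ summable_maj_comm_columns[OF K0]])
          (auto simp only: P3[OF le]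
            intro!: norm_op_comm_column_le le N K0 column_nonneg)
    qed
  qed

  have eval: "fdifferential (power_series_map sA \<alpha> \<circ> T) x h = (\<Sum>n. deriv_term n (T x) (?T' x h))"
    if "x \<in> D" for x h
    by (simp only: G_eq[OF that] G_apply[OF that])
  have op_eq: "fdifferential (power_series_map sA \<alpha> \<circ> T) x =
      series_from 1 (?P1 (T x) (?T' x)) - series_from 2 (?P3 (T x) (?T' x))" if "x \<in> D" for x
    by (simp only: G_eq[OF that] G_def pointwise2(4,5)[OF le[OF that]])
  show ?thesis
    by (intro conjI ballI allI)
      (rule diff pointwise1(1-4)[OF le] trans[OF eval pointwise1(5)[OF le]]
        trans[OF eval pointwise1(6)[OF le]] pointwise2(1-3)[OF le] op_eq impI unif1 unif2 | assumption)+
qed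

end
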